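(* Let $m,n$ be positive integers with $(m,n)\neq(1,1)$, let $\mathfrak{g}=\mathfrak{gl}_{m\vert n}$ over $\mathbb{K}$, and let $B_i,B_j\in\mathfrak{g}_1$ have ranks $r_i,r_j\in\{0,\dots,\min\{m,n\}\}$ respectively. Then $$\mathfrak{g}^{B_i}_{-1}\simeq\mathfrak{g}^{B_j}_{-1}\iff r_i=r_j,$$ where $\simeq$ denotes isomorphism of Lie algebras over $\mathbb{K}$.
   Context: $\mathbb{K}$ is a field of characteristic zero. $\mathfrak{gl}_{m\vert n}$ is the Lie superalgebra of $(m+n)\times(m+n)$ matrices $\begin{pmatrix} A & B\\ C& D\end{pmatrix}$ over $\mathbb{K}$ ($A$ of size $m\times m$, $B$ of size $m\times n$, $C$ of size $n\times m$, $D$ of size $n\times n$), with even part the block diagonal matrices, odd part the block off-diagonal matrices, and superbracket $[X,Y]=XY-(-1)^{(\deg X)(\deg Y)}YX$ for homogeneous $X,Y$. It is $\mathbb{Z}$-graded, $\mathfrak{g}=\mathfrak{g}_{-1}\oplus\mathfrak{g}_0\oplus\mathfrak{g}_1$, where $\mathfrak{g}_0$ consists of the block diagonal matrices, $\mathfrak{g}_{1}$ of the matrices $\begin{pmatrix}0&\mathbf{b}\\0&0\end{pmatrix}$ and $\mathfrak{g}_{-1}$ of the matrices $\begin{pmatrix}0&0\\ \mathbf{c}&0\end{pmatrix}$. For $B\in\mathfrak{g}_1$, $\mathfrak{g}^B_{-1}$ denotes the vector space $\mathfrak{g}_{-1}$ with the derived bracket $\llbracket X,Y\rrbracket_B=[X,[B,Y]]$,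 $X,Y\in\mathfrak{g}_{-1}$; this is a Lie algebra over $\mathbb{K}$. The rank of $B\in\mathfrak{g}_1$ is its matrix rank (equivalently that of its block $\mathbf{b}$). *)

theory Defs
  imports "HOL-Analysis.Analysis"
begin

section \<open>Lie algebras on a subspace of an ambient vector space\<close>

locale lie_algebra = vector_space scl
  for scl :: "'k::field \<Rightarrow> 'a::ab_group_add \<Rightarrow> 'a" +
  fixes L :: "'a set" and bracket :: "'a \<Rightarrow> 'a \<Rightarrow> 'a"
  assumes subspace_L: "subspace L"
    and bracket_closed: "\<And>x y. \<lbrakk>x \<in> L; y \<in> L\<rbrakk> \<Longrightarrow> bracket x y \<in> L"
    and bracket_add_left:
      "\<And>x y z. \<lbrakk>x \<in> L; y \<in> L; z \<in> L\<rbrakk> \<Longrightarrow> bracket (x + y) z = bracket x z + bracket y z"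
    and bracket_add_right:
      "\<And>x y z. \<lbrakk>x \<in> L; y \<in> L; z \<in> L\<rbrakk> \<Longrightarrow> bracket x (y + z) = bracket x y + bracket x z"
    and bracket_scale_left:
      "\<And>c x y. \<lbrakk>x \<in> L; y \<in> L\<rbrakk> \<Longrightarrow> bracket (scl c x) y = scl c (bracket x y)"
    and bracket_scale_right:
      "\<And>c x y. \<lbrakk>x \<in> L; y \<in> L\<rbrakk> \<Longrightarrow> bracket x (scl c y) = scl c (bracket x y)"
    and bracket_self: "\<And>x. x \<in> L \<Longrightarrow> bracket x x = 0"
    and jacobi: "\<And>x y z. \<lbrakk>x \<in> L; y \<in> L; z \<in> L\<rbrakk> \<Longrightarrow>
      bracket x (bracket y z) + bracket y (bracket z x) + bracket z (bracket x y) = 0"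

definition lie_isomorphic ::
  "('k \<Rightarrow> 'a::ab_group_add \<Rightarrow> 'a) \<Rightarrow> 'a set \<Rightarrow> ('a \<Rightarrow> 'a \<Rightarrow> 'a) \<Rightarrow>
   ('k \<Rightarrow> 'b::ab_group_add \<Rightarrow> 'b) \<Rightarrow> 'b set \<Rightarrow> ('b \<Rightarrow> 'b \<Rightarrow> 'b) \<Rightarrow> bool"
where
  "lie_isomorphic scl L bracket scl' L' bracket' \<longleftrightarrow>
    (\<exists>\<phi>. bij_betw \<phi> L L' \<and>
      (\<forall>x\<in>L. \<forall>y\<in>L. \<phi> (x + y) = \<phi> x + \<phi> y) \<and>
      (\<forall>c. \<forall>x\<in>L. \<phi> (scl c x) = scl' c (\<phi> x)) \<and>
      (\<forall>x\<in>L. \<forall>y\<in>L. \<phi> (bracket x y) = bracket' (\<phi> x) (\<phi> y)))"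

section \<open>The general linear Lie superalgebra\<close>

text \<open>
  Rows and columns are indexed by \<open>'m + 'n\<close>: the indices \<open>Inl i\<close> are the first \<open>m = CARD('m)\<close>
  ones and the indices \<open>Inr j\<close> the last \<open>n = CARD('n)\<close> ones.  Index types are nonempty, so
  \<open>m\<close> and \<open>n\<close> are positive.
\<close>

type_synonym ('k, 'm, 'n) gl = "'k ^ ('m + 'n) ^ ('m + 'n)"

definition mat_scale :: "'k::times \<Rightarrow> 'k ^ 'b ^ 'a \<Rightarrow> 'k ^ 'b ^ 'a"
  where "mat_scale c X = (\<chi> i j. c * X $ i $ j)"

text \<open>
  The integer degree of the matrix unit in row \<open>a\<close> and column \<open>b\<close>: it is 0 on the two
  diagonal blocks, 1 on the upper right block and -1 on the lower left block.
\<close>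

definition unit_degree :: "'m + 'n \<Rightarrow> 'm + 'n \<Rightarrow> int"
  where "unit_degree a b =
    (case (a, b) of (Inl _, Inr _) \<Rightarrow> 1 | (Inr _, Inl _) \<Rightarrow> - 1 | _ \<Rightarrow> 0)"

definition gl_component :: "int \<Rightarrow> ('k::zero, 'm::finite, 'n::finite) gl set"
  where "gl_component d = {X. \<forall>a b. X $ a $ b \<noteq> 0 \<longrightarrow> unit_degree a b = d}"

text \<open>The even (\<open>p = 0\<close>) and the odd (\<open>p = 1\<close>) component of a matrix.\<close>

definition parity_part ::
  "nat \<Rightarrow> ('k::zero, 'm::finite, 'n::finite) gl \<Rightarrow> ('k, 'm, 'n) gl"
  where "parity_part p X =
    (\<chi> a b. if even (unit_degree a b) = even p then X $ a $ b else 0)"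

text \<open>
  The bilinear extension of the superbracket of homogeneous elements;
  see \<open>superbracket_homogeneous\<close> below.
\<close>

definition superbracket ::
  "('k::field, 'm::finite, 'n::finite) gl \<Rightarrow> ('k, 'm, 'n) gl \<Rightarrow> ('k, 'm, 'n) gl"
  where "superbracket X Y = (\<Sum>p\<in>{0, 1}. \<Sum>q\<in>{0, 1}.
    parity_part p X ** parity_part q Y
      - mat_scale ((-1) ^ (p * q)) (parity_part q Y ** parity_part p X))"

definition derived_bracket ::
  "('k::field, 'm::finite, 'n::finite) gl \<Rightarrow> ('k, 'm, 'n) gl \<Rightarrow> ('k, 'm, 'n) gl \<Rightarrow> ('k, 'm, 'n) gl"
  where "derived_bracket B X Y = superbracket X (superbracket B Y)"

section \<open>Consistency of the definitions\<close>

lemma parity_part_idem: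
  assumes "parity_part p X = X" "p \<in> {0, 1}" "p' \<in> {0, 1}"
  shows "parity_part p' X = (if p' = p then X else 0)"
proof -
  have "parity_part p' (parity_part p X) = (if p' = p then parity_part p X else 0)"
    using assms(2,3) by (auto simp: parity_part_def vec_eq_iff)
  then show ?thesis using assms(1) by simp
qed

lemma mat_scale_zero [simp]: "mat_scale c (0 :: 'k::mult_zero ^ 'b ^ 'a) = 0"
  by (simp add: mat_scale_def vec_eq_iff)

lemma mat_mult_zero [simp]:
  "(X :: 'k::semiring_1 ^ 'b ^ 'a) ** (0 :: 'k ^ 'c ^ 'b) = 0"
  "(0 :: 'k::semiring_1 ^ 'b ^ 'a) ** (Y :: 'k ^ 'c ^ 'b) = 0"
  by (simp_all add: matrix_matrix_mult_def vec_eq_iff)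

lemma superbracket_homogeneous:
  fixes X Y :: "('k::field, 'm::finite, 'n::finite) gl"
  assumes "parity_part p X = X" "parity_part q Y = Y" "p \<in> {0, 1}" "q \<in> {0, 1}"
  shows "superbracket X Y = X ** Y - mat_scale ((-1) ^ (p * q)) (Y ** X)"
  using assms(3,4)
  by (auto simp: superbracket_def parity_part_idem[OF assms(1,3)] parity_part_idem[OF assms(2,4)])

lemma gl_component_parity:
  assumes "X \<in> gl_component d"
  shows "parity_part (if even d then 0 else 1) X = X"
proof -
  have "even (unit_degree a b) = even d" if "X $ a $ b \<noteq> 0" for a b
    using that assms by (auto simp: gl_component_def)
  then show ?thesis by (auto simp: parity_part_def vec_eq_iff)
qed

lemma gl_component_mult:
  fixes X Y :: "('k::semiring_1, 'm::finite, 'n::finite) gl"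
  assumes "X \<in> gl_component d" "Y \<in> gl_component e"
  shows "X ** Y \<in> gl_component (d + e)"
  unfolding gl_component_def
proof (intro CollectI allI impI)
  fix a b assume "(X ** Y) $ a $ b \<noteq> 0"
  then have "(\<Sum>c\<in>UNIV. X $ a $ c * Y $ c $ b) \<noteq> 0" by (simp add: matrix_matrix_mult_def)
  then obtain c where "X $ a $ c * Y $ c $ b \<noteq> 0" by (rule sum.not_neutral_contains_not_neutral)
  then have "X $ a $ c \<noteq> 0" "Y $ c $ b \<noteq> 0" by auto
  then have "unit_degree a c = d" "unit_degree c b = e"
    using assms by (auto simp: gl_component_def)
  moreover have "unit_degree a b = unit_degree a c + unit_degree c b"
    by (auto simp: unit_degree_def split: sum.splits)
  ultimately show "unit_degree a b = d + e" by simp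
qed

lemma gl_component_trivial:
  assumes "X \<in> gl_component d" "d \<notin> {-1, 0, 1}"
  shows "X = 0"
proof -
  have "unit_degree a b \<in> {-1, 0, 1}" for a b
    by (auto simp: unit_degree_def split: sum.splits)
  then show ?thesis using assms by (auto simp: gl_component_def vec_eq_iff)
qed

interpretation mat_scale: vector_space "mat_scale :: 'k::field \<Rightarrow> 'k ^ 'b ^ 'a \<Rightarrow> _"
  by standard (simp_all add: mat_scale_def vec_eq_iff algebra_simps)

lemma gl_component_subspace:
  "mat_scale.subspace (gl_component d :: ('k::field, 'm::finite, 'n::finite) gl set)"
proof (rule mat_scale.subspaceI)
  fix x y :: "('k, 'm, 'n) gl"
  assume "x \<in> gl_component d" "y \<in> gl_component d"
  then show "x + y \<in> gl_component d"
    by (simp add: gl_component_def) (metis add.right_neutral)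
qed (auto simp: gl_component_def mat_scale_def)

lemma mat_mult_add:
  fixes X X' :: "'k::semiring_1 ^ 'b ^ 'a" and Y Y' :: "'k ^ 'c ^ 'b"
  shows "X ** (Y + Y') = X ** Y + X ** Y'" "(X + X') ** Y = X ** Y + X' ** Y"
  by (simp_all add: matrix_matrix_mult_def vec_eq_iff sum.distrib algebra_simps)

lemma mat_mult_diff:
  fixes X X' :: "'k::ring_1 ^ 'b ^ 'a" and Y Y' :: "'k ^ 'c ^ 'b"
  shows "X ** (Y - Y') = X ** Y - X ** Y'" "(X - X') ** Y = X ** Y - X' ** Y"
  by (simp_all add: matrix_matrix_mult_def vec_eq_iff sum_subtractf algebra_simps)

lemma mat_mult_scale:
  fixes X :: "'k::comm_semiring_1 ^ 'b ^ 'a" and Y :: "'k ^ 'c ^ 'b"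
  shows "X ** mat_scale c Y = mat_scale c (X ** Y)" "mat_scale c X ** Y = mat_scale c (X ** Y)"
  by (simp_all add: matrix_matrix_mult_def mat_scale_def vec_eq_iff sum_distrib_left mult_ac)

lemma derived_bracket_eq:
  fixes B X Y :: "('k::field, 'm::finite, 'n::finite) gl"
  assumes "B \<in> gl_component 1" "X \<in> gl_component (-1)" "Y \<in> gl_component (-1)"
  shows "derived_bracket B X Y = X ** B ** Y - Y ** B ** X"
proof -
  have odd: "parity_part 1 B = B" "parity_part 1 X = X" "parity_part 1 Y = Y"
    using assms by (auto dest: gl_component_parity)
  have inner: "superbracket B Y = B ** Y + Y ** B"
    using superbracket_homogeneous[OF odd(1,3)] by (simp add: mat_scale.scale_minus_left)
  have "B ** Y + Y ** B \<in> gl_component 0"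
    using gl_component_mult[OF assms(1,3)] gl_component_mult[OF assms(3,1)]
    by (auto intro!: mat_scale.subspace_add[OF gl_component_subspace])
  then have even: "parity_part 0 (B ** Y + Y ** B) = B ** Y + Y ** B"
    by (auto dest: gl_component_parity)
  have XY: "X ** Y = 0" "Y ** X = 0"
    using gl_component_mult[OF assms(2,3)] gl_component_mult[OF assms(3,2)]
    by (auto intro: gl_component_trivial)
  have "Y ** (B ** X) = Y ** B ** X" "X ** (Y ** B) = 0" "B ** Y ** X = 0"
    using XY by (simp_all add: matrix_mul_assoc flip: matrix_mul_assoc[of B])
  then show ?thesis
    using superbracket_homogeneous[OF odd(2) even]
    by (simp add: derived_bracket_def inner mat_mult_add matrix_mul_assoc)
qed

lemma lie_algebra_derived_bracket:
  fixes B :: "('k::field, 'm::finite, 'n::finite) gl"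
  assumes B: "B \<in> gl_component 1"
  shows "lie_algebra mat_scale (gl_component (-1)) (derived_bracket B)"
proof -
  note sub = mat_scale.subspace_add[OF gl_component_subspace]
    mat_scale.subspace_scale[OF gl_component_subspace]
    mat_scale.subspace_diff[OF gl_component_subspace]
  have closed: "X ** B ** Y - Y ** B ** X \<in> gl_component (-1)"
    if "X \<in> gl_component (-1)" "Y \<in> gl_component (-1)" for X Y
    using gl_component_mult[OF gl_component_mult[OF that(1) B] that(2)]
      gl_component_mult[OF gl_component_mult[OF that(2) B] that(1)]
    by (auto intro!: sub)
  show ?thesis
    by unfold_locales
      (simp_all add: gl_component_subspace derived_bracket_eq[OF B] sub closed mat_mult_diff
        mat_mult_add mat_mult_scale matrix_mul_assoc
        mat_scale.scale_right_diff_distrib algebra_simps)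
qed

end

theory Submission
  imports Defs
begin

text \<open>
  The rank normal form \<open>b = P N Q\<close> reduces everything to a partial permutation matrix \<open>N\<close> of rank
  \<open>r\<close>, since \<open>X \<mapsto> Q X P\<close> carries the bracket \<open>X b Y - Y b X\<close> to \<open>X N Y - Y N X\<close>.  Conversely,
  an element \<open>X\<close> of the centre satisfies \<open>X b = c\<close> and \<open>b X = c\<close> for a scalar \<open>c\<close>; if \<open>X\<close> is also
  a linear combination of brackets, then \<open>X b\<close> has trace zero, so \<open>c = 0\<close> in characteristic zero.
  Hence, for \<open>b \<noteq> 0\<close>, the intersection of the centre with the derived algebra is
  \<open>{X. X b = 0 \<and> b X = 0}\<close>, of dimension \<open>(m - r) (n - r)\<close>, which determines \<open>r\<close>.  (The centre alone
  does not: for \<open>m = n\<close> it is one-dimensional both for \<open>r = n\<close> and for \<open>r = n - 1\<close>.)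
  The case \<open>b = 0\<close> is singled out by commutativity, as \<open>(m, n) \<noteq> (1, 1)\<close>.
\<close>

section \<open>Isomorphisms of Lie algebras\<close>

lemma lie_isomorphic_trans:
  assumes "lie_isomorphic s L b s' L' b'" "lie_isomorphic s' L' b' s'' L'' b''"
  shows "lie_isomorphic s L b s'' L'' b''"
proof -
  obtain f where f: "bij_betw f L L'" "\<forall>x\<in>L. \<forall>y\<in>L. f (x + y) = f x + f y"
    "\<forall>c. \<forall>x\<in>L. f (s c x) = s' c (f x)" "\<forall>x\<in>L. \<forall>y\<in>L. f (b x y) = b' (f x) (f y)"
    using assms(1) unfolding lie_isomorphic_def by blast
  obtain g where g: "bij_betw g L' L''" "\<forall>x\<in>L'. \<forall>y\<in>L'. g (x + y) = g x + g y"
    "\<forall>c. \<forall>x\<in>L'. g (s' c x) = s'' c (g x)" "\<forall>x\<in>L'. \<forall>y\<in>L'. g (b' x y) = b'' (g x) (g y)"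
    using assms(2) unfolding lie_isomorphic_def by blast
  have "f x \<in> L'" if "x \<in> L" for x
    using that f(1) by (rule bij_betw_apply[rotated])
  then show ?thesis
    unfolding lie_isomorphic_def
    by (intro exI[of _ "g \<circ> f"]) (simp add: bij_betw_trans[OF f(1) g(1)] f g)
qed

text \<open>Closure of the source under sums, scaling and brackets lets the inverse map respect
  these operations, hence the locale; \<open>lie_isomorphic\<close> itself does not demand
  closure.\<close>

lemma (in lie_algebra) lie_isomorphic_sym:
  assumes "lie_isomorphic scl L bracket s' L' b'"
  shows "lie_isomorphic s' L' b' scl L bracket"
proof -
  obtain f where f: "bij_betw f L L'" "\<forall>x\<in>L. \<forall>y\<in>L. f (x + y) = f x + f y"
    "\<forall>c. \<forall>x\<in>L. f (scl c x) = s' c (f x)" "\<forall>x\<in>L. \<forall>y\<in>L. f (bracket x y) = b' (f x) (f y)"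
    using assms unfolding lie_isomorphic_def by blast
  let ?g = "inv_into L f"
  have g: "?g y \<in> L" "f (?g y) = y" if "y \<in> L'" for y
    using that f(1) by (auto simp: bij_betw_def inv_into_into f_inv_into_f)
  have gI: "?g y = x" if "x \<in> L" "f x = y" for x y
    using that f(1) by (auto simp: bij_betw_def)
  show ?thesis
    unfolding lie_isomorphic_def
    by (intro exI[of _ ?g] conjI ballI allI)
      (auto intro!: gI bij_betw_inv_into[OF f(1)] bracket_closed subspace_add[OF subspace_L]
        subspace_scale[OF subspace_L] simp: f g)
qed

section \<open>Equivalence of matrices of equal rank\<close>

text \<open>The index types carry no order, so a set \<open>K\<close> of rows and a map
  \<open>h\<close> to columns replace the usual block normal form. For \<open>h\<close> injective on
  \<open>K\<close> this is a partial permutation matrix of rank \<open>card K\<close>.\<close>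

definition pivot_matrix :: "'m set \<Rightarrow> ('m \<Rightarrow> 'n) \<Rightarrow> 'k::zero_neq_one ^ 'n ^ 'm"
  where "pivot_matrix K h = (\<chi> i j. if i \<in> K \<and> h i = j then 1 else 0)"

lemma invertible_basis_rows:
  fixes g :: "'n::finite \<Rightarrow> 'k::field ^ 'n"
  assumes "vec.span (range g) = UNIV"
  shows "invertible (\<chi> i. g i)"
proof -
  have "rows (\<chi> i. g i) = range g"
    by (auto simp: rows_def row_def vec_lambda_eta)
  then show ?thesis
    using assms by (simp add: invertible_left_inverse matrix_left_invertible_span_rows_gen)
qed

text \<open>The vectors \<open>v v* A\<close> are the linear combinations of the rows, so they fill
  the row space.\<close>

lemma rank_eq_dim_range:
  fixes A :: "'k::field ^ 'n ^ 'm"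
  shows "vec.dim (range (\<lambda>v. v v* A)) = rank A"
proof -
  have "range (\<lambda>v. v v* A) = vec.span (rows A)"
  proof
    show "range (\<lambda>v. v v* A) \<subseteq> vec.span (rows A)"
    proof clarify
      fix v
      have "v v* A = (\<Sum>i\<in>UNIV. v $ i *s row i A)"
        by (simp add: vector_matrix_mult_def vec_eq_iff row_def)
      also have "\<dots> \<in> vec.span (rows A)"
        by (intro vec.span_sum vec.span_scale vec.span_base) (auto simp: rows_def)
      finally show "v v* A \<in> vec.span (rows A)" .
    qed
    have "row i A = axis i 1 v* A" for i
      by (simp add: vector_matrix_mult_def vec_eq_iff row_def axis_def if_distrib[of "\<lambda>x. x * _"] cong: if_cong)
    then have "rows A \<subseteq> range ((*v) (transpose A))"
      by (auto simp: rows_def)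
    then show "vec.span (rows A) \<subseteq> range (\<lambda>v. v v* A)"
      using vec.span_minimal[OF _ vec.subspace_image[OF vec.subspace_UNIV], of "rows A" "transpose A"]
      by simp
  qed
  then show ?thesis
    by (simp add: row_rank_def_gen)
qed

text \<open>The complements have equal size, so any bijection between them completes
  \<open>f\<close>. This indexes a completed basis while keeping a prescribed indexing of part of
  it.\<close>

lemma bij_betw_extend:
  assumes "bij_betw f A B" "finite A'" "finite B'" "A \<subseteq> A'" "B \<subseteq> B'" "card A' = card B'"
  obtains g where "bij_betw g A' B'" "\<And>x. x \<in> A \<Longrightarrow> g x = f x"
proof -
  have "card (A' - A) = card (B' - B)"
    using assms bij_betw_same_card[OF assms(1)]
    by (simp add: card_Diff_subset finite_subset[of A A'] finite_subset[of B B'])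
  then obtain k where k: "bij_betw k (A' - A) (B' - B)"
    using assms(2,3) finite_same_card_bij[of "A' - A" "B' - B"] by auto
  let ?g = "\<lambda>x. if x \<in> A then f x else k x"
  have "bij_betw ?g A B" "bij_betw ?g (A' - A) (B' - B)"
    using assms(1) k by (subst bij_betw_cong[where g = f] bij_betw_cong[where g = k]; simp)+
  from bij_betw_combine[OF this] have "bij_betw ?g A' B'"
    using assms(4,5) by (simp add: Un_absorb1)
  then show ?thesis using that[of ?g] by simp
qed

text \<open>Complete a basis \<open>Z\<close> of the left kernel of \<open>A\<close> by
  \<open>C\<close> to a basis of the whole space; then \<open>A\<close> maps \<open>C\<close> to a
  basis of the row space. With the first basis as rows of \<open>G\<close> and a completion of the
  second as rows of \<open>Q\<close>, indexed compatibly with \<open>K\<close> and \<open>h\<close>,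
  one gets \<open>G ** A = pivot_matrix K h ** Q\<close>, and \<open>P\<close> is the inverse of
  \<open>G\<close>.\<close>

lemma rank_normal_form:
  fixes A :: "'k::field ^ 'n ^ 'm"
  assumes h: "inj_on h K" and card: "card K = rank A"
  obtains P :: "'k ^ 'm ^ 'm" and Q :: "'k ^ 'n ^ 'n"
  where "invertible P" "invertible Q" "A = P ** pivot_matrix K h ** Q"
proof -
  let ?f = "(*v) (transpose A)"
  obtain Z where Z: "Z \<subseteq> {v. ?f v = 0}" "vec.independent Z" "{v. ?f v = 0} \<subseteq> vec.span Z"
    using vec.basis_exists[of "{v. ?f v = 0}"] by metis
  define E where "E = vec.extend_basis Z"
  note E = vec.extend_basis_superset[OF Z(2), folded E_def]
    vec.independent_extend_basis[OF Z(2), folded E_def]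
    vec.span_extend_basis[OF Z(2), folded E_def]
  define C where "C = E - Z"
  have C: "vec.independent C" "C \<subseteq> E"
    using vec.independent_mono[OF E(2)] by (auto simp: C_def)
  \<comment> \<open>The coordinates of \<open>v\<close> in the basis \<open>E\<close> are supported
    both in \<open>Z\<close> and in its complement \<open>C\<close>, so all of them vanish.\<close>
  have "v = 0" if "v \<in> vec.span C" "?f v = 0" for v
  proof -
    have "v \<in> vec.span Z" using that(2) Z(3) by auto
    then have "vec.representation Z v = vec.representation C v"
      using vec.representation_extend[OF E(2) _ E(1)] vec.representation_extend[OF E(2) that(1) C(2)]
      by metis
    then have "vec.representation C v b = 0" for b
      using vec.representation_ne_zero[of C v b] vec.representation_ne_zero[of Z v b]
      by (auto simp: C_def)
    then show "v = 0"
      using vec.sum_nonzero_representation_eq[OF C(1) that(1)] by simp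
  qed
  then have inj: "inj_on ?f (vec.span C)"
    by (subst vec.linear_inj_on_iff_eq_0) auto
  have indep: "vec.independent (?f ` C)"
    using vec.independent_injective_image[OF C(1) inj] .
  have "?f ` E \<subseteq> insert 0 (?f ` C)"
    using Z(1) by (auto simp: C_def)
  then have "vec.span (?f ` E) \<subseteq> vec.span (?f ` C)"
    using vec.span_mono[of "?f ` E" "insert 0 (?f ` C)"] by simp
  moreover have "vec.span (?f ` C) \<subseteq> vec.span (?f ` E)"
    using C(2) by (intro vec.span_mono) auto
  moreover have "vec.span (?f ` E) = range ?f"
    using E(3) by (simp only: vec.linear_span_image[OF matrix_vector_mul_linear_gen])
  ultimately have "range ?f = vec.span (?f ` C)" by simp
  then have "card (?f ` C) = rank A"
    using rank_eq_dim_range[of A] vec.dim_eq_card_independent[OF indep] by simp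
  moreover have "card (?f ` C) = card C"
    using inj vec.span_superset by (intro card_image) (rule inj_on_subset)
  ultimately have cardC: "card C = card K" using card by simp
  have finE: "finite E" using vec.finiteI_independent[OF E(2)] .
  have cardE: "card E = CARD('m)"
    using vec.dim_eq_card_independent[OF E(2)] vec.dim_span[of E] E(3) by (simp add: card_cart_basis)
  obtain g0 where g0: "bij_betw g0 K C"
    using finite_same_card_bij[of K C] finite_subset[OF C(2) finE] cardC by auto
  \<comment> \<open>Indices in \<open>K\<close> enumerate \<open>C\<close>; the remaining ones then
    enumerate \<open>Z\<close>, which \<open>A\<close> kills.\<close>
  obtain g where g_ext: "bij_betw g UNIV E" "\<And>x. x \<in> K \<Longrightarrow> g x = g0 x"
    using bij_betw_extend[OF g0 finite finE subset_UNIV C(2)] cardE by metis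
  have g: "bij_betw g UNIV E" "bij_betw g K C"
    using g_ext g0 by (simp_all cong: bij_betw_cong)
  have gK: "?f (g i) = 0" if "i \<notin> K" for i
  proof -
    have "g i \<in> E" "g i \<notin> C"
      using that g by (auto simp: bij_betw_def inj_on_def)
    then show ?thesis using Z(1) by (auto simp: C_def)
  qed
  define D where "D = vec.extend_basis (?f ` C)"
  note D = vec.extend_basis_superset[OF indep, folded D_def]
    vec.independent_extend_basis[OF indep, folded D_def]
    vec.span_extend_basis[OF indep, folded D_def]
  have finD: "finite D" using vec.finiteI_independent[OF D(2)] .
  have cardD: "card D = CARD('n)"
    using vec.dim_eq_card_independent[OF D(2)] vec.dim_span[of D] D(3) by (simp add: card_cart_basis)
  have "bij_betw ?f C (?f ` C)"
    using inj_on_subset[OF inj vec.span_superset] by (rule inj_on_imp_bij_betw)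
  \<comment> \<open>Column index \<open>h i\<close> receives the image of \<open>g i\<close>; this
    is well defined since \<open>h\<close> is injective on \<open>K\<close>.\<close>
  then have bij: "bij_betw (?f \<circ> (g \<circ> inv_into K h)) (h ` K) (?f ` C)"
    using bij_betw_inv_into[OF inj_on_imp_bij_betw[OF h]] g(2) by (blast intro: bij_betw_trans)
  then obtain k where k: "bij_betw k UNIV D"
    "\<And>x. x \<in> h ` K \<Longrightarrow> k x = (?f \<circ> (g \<circ> inv_into K h)) x"
    using bij_betw_extend[OF bij finite finD subset_UNIV D(1)] cardD by metis
  have kh: "k (h i) = ?f (g i)" if "i \<in> K" for i
    using that k(2)[of "h i"] h by simp
  define G where "G = (\<chi> i. g i)"
  define Q where "Q = (\<chi> j. k j)"
  have inv: "invertible G" "invertible Q"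
    using g(1) k(1) E(3) D(3) unfolding G_def Q_def
    by (auto intro!: invertible_basis_rows simp: bij_betw_def)
  have "(G ** A) $ i = (pivot_matrix K h ** Q) $ i" for i
  proof -
    have "(G ** A) $ i = ?f (g i)"
      by (simp add: G_def matrix_matrix_mult_def vector_matrix_mult_def vec_eq_iff mult.commute)
    moreover have "(pivot_matrix K h ** Q) $ i = (if i \<in> K then k (h i) else 0)"
      by (simp add: pivot_matrix_def Q_def matrix_matrix_mult_def vec_eq_iff if_distrib[of "\<lambda>x. x * _"]
          cong: if_cong)
    ultimately show ?thesis using gK kh by simp
  qed
  then have GA: "G ** A = pivot_matrix K h ** Q" by (simp add: vec_eq_iff)
  obtain P where P: "P ** G = mat 1" "G ** P = mat 1"
    using inv(1) by (auto simp: invertible_def)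
  have "A = P ** pivot_matrix K h ** Q"
    using P(1) by (metis GA matrix_mul_assoc matrix_mul_lid)
  moreover have "invertible P" using P by (auto simp: invertible_def)
  ultimately show ?thesis using that inv(2) by blast
qed

section \<open>The rectangular model of the derived bracket\<close>

text \<open>The derived bracket as seen on lower left blocks, with \<open>b\<close> the upper right
  block of \<open>B\<close>.\<close>

definition sandwich_bracket ::
  "'k::field ^ 'n ^ 'm \<Rightarrow> 'k ^ 'm ^ 'n \<Rightarrow> 'k ^ 'm ^ 'n \<Rightarrow> 'k ^ 'm ^ 'n"
  where "sandwich_bracket b X Y = X ** b ** Y - Y ** b ** X"

definition upper_block :: "('k, 'm::finite, 'n::finite) gl \<Rightarrow> 'k ^ 'n ^ 'm"
  where "upper_block B = (\<chi> i j. B $ Inl i $ Inr j)"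

definition lower_block :: "('k, 'm::finite, 'n::finite) gl \<Rightarrow> 'k ^ 'm ^ 'n"
  where "lower_block X = (\<chi> j i. X $ Inr j $ Inl i)"

lemma lie_algebra_sandwich: "lie_algebra mat_scale UNIV (sandwich_bracket b)"
  by unfold_locales
    (simp_all add: sandwich_bracket_def mat_mult_diff mat_mult_add mat_mult_scale matrix_mul_assoc
      mat_scale.scale_right_diff_distrib algebra_simps)

lemma sum_sum_type:
  fixes f :: "'m::finite + 'n::finite \<Rightarrow> 'a::comm_monoid_add"
  shows "(\<Sum>a\<in>UNIV. f a) = (\<Sum>i\<in>UNIV. f (Inl i)) + (\<Sum>j\<in>UNIV. f (Inr j))"
  by (simp add: UNIV_Plus_UNIV[symmetric] sum.Plus del: UNIV_Plus_UNIV)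

lemma gl_component_block_zero:
  "X \<in> gl_component d \<Longrightarrow> unit_degree a b \<noteq> d \<Longrightarrow> X $ a $ b = 0"
  by (auto simp: gl_component_def)

lemma derived_bracket_sandwich:
  fixes B :: "('k::field, 'm::finite, 'n::finite) gl"
  assumes B: "B \<in> gl_component 1"
  shows "lie_isomorphic mat_scale (gl_component (-1)) (derived_bracket B)
    mat_scale UNIV (sandwich_bracket (upper_block B))"
proof -
  \<comment> \<open>The inverse pads a lower left block with zeros.\<close>
  have "bij_betw lower_block (gl_component (-1)) (UNIV :: ('k ^ 'm ^ 'n) set)"
  proof (rule bij_betw_byWitness[where f' = "\<lambda>X. \<chi> a b. case (a, b) of (Inr j, Inl i) \<Rightarrow> X $ j $ i | _ \<Rightarrow> 0"])
    show "\<forall>X\<in>gl_component (-1). (\<chi> a b. case (a, b) of (Inr j, Inl i) \<Rightarrow> lower_block X $ j $ i | _ \<Rightarrow> 0) = (X :: ('k, 'm, 'n) gl)"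
      by (auto simp: vec_eq_iff lower_block_def gl_component_block_zero unit_degree_def split: sum.splits)
  qed (auto simp: vec_eq_iff lower_block_def gl_component_def unit_degree_def split: sum.splits)
  moreover have "lower_block (X ** B ** Y) = lower_block X ** upper_block B ** lower_block Y"
    if "X \<in> gl_component (-1)" "Y \<in> gl_component (-1)" for X Y
    using that B
    by (simp add: vec_eq_iff lower_block_def upper_block_def matrix_matrix_mult_def sum_sum_type
        gl_component_block_zero unit_degree_def)
  ultimately show ?thesis
    unfolding lie_isomorphic_def
    by (intro exI[of _ lower_block])
      (auto simp: derived_bracket_eq[OF B] sandwich_bracket_def lower_block_def mat_scale_def vec_eq_iff)
qed

text \<open>The rows of \<open>B\<close> are zero or rows of its block padded by zeros on the left;
  the padding \<open>e\<close> is linear and injective, so it preserves the dimension of the row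
  space.\<close>

lemma rank_upper_block:
  fixes B :: "('k::field, 'm::finite, 'n::finite) gl"
  assumes B: "B \<in> gl_component 1"
  shows "rank (upper_block B) = rank B"
proof -
  define e :: "'k ^ 'n \<Rightarrow> 'k ^ ('m + 'n)"
    where "e v = (\<chi> a. case a of Inl _ \<Rightarrow> 0 | Inr j \<Rightarrow> v $ j)" for v
  have lin: "Vector_Spaces.linear (*s) (*s) e"
    by unfold_locales (auto simp: e_def vec_eq_iff algebra_simps split: sum.splits)
  have "inj e"
    by (auto simp: inj_on_def e_def vec_eq_iff split: sum.splits)
  have "row (Inl i) B = e (row i (upper_block B))" for i
    using B by (auto simp: e_def row_def upper_block_def vec_eq_iff gl_component_block_zero unit_degree_def
        split: sum.splits)
  moreover have "row (Inr j) B = 0" for j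
    using B by (auto simp: row_def vec_eq_iff gl_component_block_zero unit_degree_def split: sum.splits)
  ultimately have "rows B = insert 0 (e ` rows (upper_block B))"
    unfolding rows_def by (auto simp: image_iff) (metis sum.exhaust)+
  then have "rank B = vec.dim (e ` rows (upper_block B))"
    unfolding row_rank_def_gen by (metis vec.dim_span vec.span_insert_0)
  also have "\<dots> = rank (upper_block B)"
    unfolding row_rank_def_gen using lin inj_on_subset[OF \<open>inj e\<close>]
    by (intro vec.dim_image_eq) auto
  finally show ?thesis by simp
qed

text \<open>With \<open>f X = Q X P\<close>, associativity gives
  \<open>f (X (P b Q) Y) = (f X) b (f Y)\<close>.\<close>

lemma sandwich_isomorphic_equivalent:
  fixes b :: "'k::field ^ 'n ^ 'm" and P :: "'k ^ 'm ^ 'm" and Q :: "'k ^ 'n ^ 'n"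
  assumes P: "invertible P" and Q: "invertible Q"
  shows "lie_isomorphic mat_scale UNIV (sandwich_bracket (P ** b ** Q)) mat_scale UNIV (sandwich_bracket b)"
proof -
  obtain P' where P': "P ** P' = mat 1" "P' ** P = mat 1"
    using P by (auto simp: invertible_def)
  obtain Q' where Q': "Q ** Q' = mat 1" "Q' ** Q = mat 1"
    using Q by (auto simp: invertible_def)
  have cancel: "Q' ** (Q ** X) = X" "Q ** (Q' ** X) = X" for X :: "'k ^ 'm ^ 'n"
    by (simp_all add: matrix_mul_assoc Q')
  define f where "f X = Q ** X ** P" for X
  have "bij f"
  proof (rule o_bij)
    show "(\<lambda>X. Q' ** X ** P') \<circ> f = id" "f \<circ> (\<lambda>X. Q' ** X ** P') = id"
      using P' by (simp_all add: f_def fun_eq_iff cancel flip: matrix_mul_assoc)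
  qed
  then show ?thesis
    unfolding lie_isomorphic_def
    by (intro exI[of _ f])
      (simp add: f_def sandwich_bracket_def mat_mult_add mat_mult_diff mat_mult_scale matrix_mul_assoc)
qed

section \<open>The central part of the derived algebra\<close>

definition annihilator :: "'k::field ^ 'n ^ 'm \<Rightarrow> ('k ^ 'm ^ 'n) set"
  where "annihilator b = {X. X ** b = 0 \<and> b ** X = 0}"

definition center :: "('a \<Rightarrow> 'a \<Rightarrow> 'a::zero) \<Rightarrow> 'a set"
  where "center br = {X. \<forall>Y. br X Y = 0}"

definition matrix_unit :: "'n \<Rightarrow> 'm \<Rightarrow> 'k::zero_neq_one ^ 'm ^ 'n"
  where "matrix_unit p q = (\<chi> i j. if i = p \<and> j = q then 1 else 0)"

lemma mult_matrix_unit: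
  fixes A :: "'k::field ^ 'n ^ 'l"
  shows "(A ** matrix_unit p q) $ i $ j = (if j = q then A $ i $ p else 0)"
  by (simp add: matrix_unit_def matrix_matrix_mult_def if_distrib[of "\<lambda>x. _ * x"] cong: if_cong)

lemma matrix_unit_mult:
  fixes A :: "'k::field ^ 'n ^ 'm"
  shows "(matrix_unit p q ** A) $ i $ j = (if i = p then A $ q $ j else 0)"
  by (simp add: matrix_unit_def matrix_matrix_mult_def if_distrib[of "\<lambda>x. x * _"] cong: if_cong)

text \<open>Testing centrality on matrix units \<open>E\<close> gives
  \<open>(X b) E = E (b X)\<close>. Comparing entries kills the off-diagonal ones and identifies all
  diagonal ones, of both products.\<close>

lemma center_sandwich:
  fixes b :: "'k::field ^ 'n ^ 'm"
  assumes "X \<in> center (sandwich_bracket b)"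
  obtains c where "X ** b = mat c" "b ** X = mat c"
proof -
  have eq: "((X ** b) ** matrix_unit p q) $ i $ j = (matrix_unit p q ** (b ** X)) $ i $ j" for p q i j
    using assms by (simp add: center_def sandwich_bracket_def matrix_mul_assoc)
  have eq: "(if j = q then (X ** b) $ i $ p else 0) = (if i = p then (b ** X) $ q $ j else 0)" for p q i j
    using eq[of p q i j] by (simp only: mult_matrix_unit matrix_unit_mult)
  \<comment> \<open>Here \<open>undefined\<close> is just some fixed index; every diagonal entry
    will equal this one.\<close>
  define c where "c = (X ** b) $ undefined $ undefined"
  have bX: "(b ** X) $ q $ j = (if q = j then c else 0)" for q j
    using eq[of j q undefined undefined] by (auto simp: c_def)
  have "(X ** b) $ i $ p = (if i = p then c else 0)" for i p
    using eq[of undefined undefined i p] bX by auto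
  then show ?thesis
    using bX by (intro that[of c]) (auto simp: mat_def vec_eq_iff)
qed

lemma center_Int_derived_sandwich:
  fixes b :: "'k::field_char_0 ^ 'n ^ 'm"
  assumes "b \<noteq> 0"
  shows "center (sandwich_bracket b) \<inter> mat_scale.span (range (\<lambda>(X, Y). sandwich_bracket b X Y))
    = annihilator b"
proof (intro equalityI subsetI)
  fix X assume X: "X \<in> center (sandwich_bracket b) \<inter> mat_scale.span (range (\<lambda>(X, Y). sandwich_bracket b X Y))"
  then obtain c where c: "X ** b = mat c" "b ** X = mat c"
    using center_sandwich by blast
  have "X \<in> mat_scale.span (range (\<lambda>(X, Y). sandwich_bracket b X Y))" using X by simp
  \<comment> \<open>By cyclicity of the trace, \<open>U b V b\<close> and \<open>V b U b\<close>
    have equal trace, so \<open>trace (_ ** b)\<close> vanishes on brackets.\<close>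
  then have "trace (X ** b) = 0"
  proof (induction rule: mat_scale.span_induct_alt)
    case (step d Y Z)
    then obtain U V where "Y = sandwich_bracket b U V" by auto
    moreover have "trace (U ** b ** V ** b) = trace (V ** b ** U ** b)"
      by (metis matrix_mul_assoc trace_mul_sym)
    moreover have "trace (mat_scale d W) = d * trace W" for W :: "'k ^ 'n ^ 'n"
      by (simp add: trace_def mat_scale_def sum_distrib_left)
    ultimately show ?case
      using step by (simp add: sandwich_bracket_def mat_mult_add mat_mult_diff mat_mult_scale trace_add trace_sub)
  qed (simp add: trace_def)
  \<comment> \<open>The trace of \<open>mat c\<close> is \<open>c\<close> times the size, which is
    nonzero in characteristic zero.\<close>
  then have "c = 0" by (simp add: c trace_def mat_def)
  then show "X \<in> annihilator b" using c by (simp add: annihilator_def mat_def vec_eq_iff)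
next
  fix X assume X: "X \<in> annihilator b"
  obtain p q where pq: "b $ p $ q \<noteq> 0"
    using assms by (auto simp: vec_eq_iff)
  \<comment> \<open>The bracket of \<open>E\<^sub>i\<^sub>p\<close> and \<open>E\<^sub>q\<^sub>j\<close> is \<open>b\<^sub>p\<^sub>q E\<^sub>i\<^sub>j - b\<^sub>j\<^sub>i E\<^sub>q\<^sub>p\<close>; the \<open>E\<^sub>q\<^sub>p\<close> terms add up to
    a multiple of the trace of \<open>X b\<close>.\<close>
  have "X = (\<Sum>i\<in>UNIV. \<Sum>j\<in>UNIV. mat_scale (X $ i $ j / b $ p $ q)
      (sandwich_bracket b (matrix_unit i p) (matrix_unit q j)))" (is "X = ?S")
  proof -
    have "trace (X ** b) = 0"
      using X by (simp add: annihilator_def trace_def)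
    then have tr: "(\<Sum>i\<in>UNIV. \<Sum>j\<in>UNIV. X $ i $ j * b $ j $ i) = 0"
      by (simp add: trace_def matrix_matrix_mult_def)
    have "?S $ k $ l = X $ k $ l" for k l
    proof -
      have "sandwich_bracket b (matrix_unit i p) (matrix_unit q j) $ k $ l
        = (if i = k \<and> j = l then b $ p $ q else 0) - (if k = q \<and> l = p then b $ j $ i else 0)" for i j
        by (auto simp: sandwich_bracket_def mult_matrix_unit matrix_unit_mult)
      then have entry: "mat_scale (X $ i $ j / b $ p $ q) (sandwich_bracket b (matrix_unit i p) (matrix_unit q j)) $ k $ l
        = (if j = l then if i = k then X $ i $ j else 0 else 0)
          - X $ i $ j * b $ j $ i * (if k = q \<and> l = p then 1 / b $ p $ q else 0)" for i j
        using pq by (auto simp: mat_scale_def right_diff_distrib)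
      have "?S $ k $ l = (\<Sum>i\<in>UNIV. \<Sum>j\<in>UNIV. (if j = l then if i = k then X $ i $ j else 0 else 0)
          - X $ i $ j * b $ j $ i * (if k = q \<and> l = p then 1 / b $ p $ q else 0))"
        by (simp only: sum_component entry)
      also have "\<dots> = X $ k $ l - (\<Sum>i\<in>UNIV. \<Sum>j\<in>UNIV. X $ i $ j * b $ j $ i)
          * (if k = q \<and> l = p then 1 / b $ p $ q else 0)"
        by (simp only: sum_subtractf sum_distrib_right) (simp add: sum.delta cong: if_cong)
      finally show ?thesis by (simp add: tr)
    qed
    then show ?thesis by (simp add: vec_eq_iff)
  qed
  also have "\<dots> \<in> mat_scale.span (range (\<lambda>(X, Y). sandwich_bracket b X Y))"
    by (intro mat_scale.span_sum mat_scale.span_scale mat_scale.span_base) auto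
  finally show "X \<in> center (sandwich_bracket b) \<inter> mat_scale.span (range (\<lambda>(X, Y). sandwich_bracket b X Y))"
    using X by (auto simp: center_def annihilator_def sandwich_bracket_def simp flip: matrix_mul_assoc[of _ b X])
qed

text \<open>For \<open>i\<close> in \<open>K\<close>, left multiplication by the pivot matrix reads
  off row \<open>h i\<close> of \<open>X\<close> and right multiplication reads off column
  \<open>i\<close>. The annihilator is thus a coordinate subspace, whose dimension is a count of
  positions.\<close>

lemma annihilator_pivot_matrix:
  assumes "inj_on h K"
  shows "annihilator (pivot_matrix K h :: 'k::field ^ 'n ^ 'm)
    = {X. \<forall>j i. (j, i) \<notin> (- h ` K) \<times> (- K) \<longrightarrow> X $ j $ i = 0}"
proof (intro equalityI subsetI)
  let ?N = "pivot_matrix K h :: 'k ^ 'n ^ 'm"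
  have left: "(?N ** X) $ i $ l = (if i \<in> K then X $ h i $ l else 0)" for X :: "'k ^ 'm ^ 'n" and i l
    by (simp add: pivot_matrix_def matrix_matrix_mult_def if_distrib[of "\<lambda>x. x * _"] cong: if_cong)
  have N: "?N $ i' $ h i = (if i' = i then 1 else 0)" if "i \<in> K" for i i'
    using assms that by (auto simp: pivot_matrix_def inj_on_def)
  have right: "(X ** ?N) $ k $ h i = X $ k $ i" if "i \<in> K" for X :: "'k ^ 'm ^ 'n" and i k
    by (simp add: matrix_matrix_mult_def N[OF that] if_distrib[of "\<lambda>x. _ * x"] cong: if_cong)
  fix X :: "'k ^ 'm ^ 'n"
  {
    assume "X \<in> annihilator ?N"
    then have "X ** ?N = 0" "?N ** X = 0"
      by (simp_all add: annihilator_def)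
    then have "X $ k $ i = 0" "X $ h i $ l = 0" if "i \<in> K" for i k l
      using left[of X i l] right[OF that, of X k] that by simp_all
    then show "X \<in> {X. \<forall>j i. (j, i) \<notin> (- h ` K) \<times> (- K) \<longrightarrow> X $ j $ i = 0}"
      by auto
  next
    assume X: "X \<in> {X. \<forall>j i. (j, i) \<notin> (- h ` K) \<times> (- K) \<longrightarrow> X $ j $ i = 0}"
    then have "?N ** X = 0" by (auto simp: vec_eq_iff left)
    moreover have "X ** ?N = 0"
      using X by (auto simp: vec_eq_iff matrix_matrix_mult_def pivot_matrix_def intro!: sum.neutral)
    ultimately show "X \<in> annihilator ?N" by (simp add: annihilator_def)
  }
qed

text \<open>The two coordinate subspaces have dimensions \<open>card S\<close> and
  \<open>card T\<close>, and injective linear maps preserve dimension.\<close>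

lemma card_eq_of_linear_bij:
  fixes f :: "'k::field ^ 'm ^ 'n \<Rightarrow> 'k ^ 'm ^ 'n"
  assumes lin: "Vector_Spaces.linear mat_scale mat_scale f" and "inj f"
    and im: "f ` {X. \<forall>j i. (j, i) \<notin> S \<longrightarrow> X $ j $ i = 0} = {X. \<forall>j i. (j, i) \<notin> T \<longrightarrow> X $ j $ i = 0}"
  shows "card S = card T"
proof -
  \<comment> \<open>Matrices are flattened to vectors indexed by pairs, where \<open>vec.dim\<close>
    applies.\<close>
  define flat :: "'k ^ 'm ^ 'n \<Rightarrow> 'k ^ ('n \<times> 'm)" where "flat X = (\<chi> p. X $ fst p $ snd p)" for X
  define unflat :: "'k ^ ('n \<times> 'm) \<Rightarrow> 'k ^ 'm ^ 'n" where "unflat x = (\<chi> j i. x $ (j, i))" for x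
  let ?g = "flat \<circ> f \<circ> unflat"
  let ?supp = "\<lambda>S. {x :: 'k ^ ('n \<times> 'm). \<forall>p. p \<notin> S \<longrightarrow> x $ p = 0}"
  interpret f: Vector_Spaces.linear mat_scale mat_scale f by fact
  have inverse: "unflat (flat X) = X" "flat (unflat x) = x" for X x
    by (auto simp: flat_def unflat_def vec_eq_iff)
  have add: "flat (X + Y) = flat X + flat Y" "unflat (x + y) = unflat x + unflat y" for X Y x y
    by (auto simp: flat_def unflat_def vec_eq_iff)
  have scale: "flat (mat_scale c X) = c *s flat X" "unflat (c *s x) = mat_scale c (unflat x)" for c X x
    by (auto simp: flat_def unflat_def mat_scale_def vec_eq_iff)
  have lin: "Vector_Spaces.linear (*s) (*s) ?g"
    by unfold_locales (auto simp: add scale f.add f.scale)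
  have "inj flat" "inj unflat"
    by (rule inj_on_inverseI, rule inverse)+
  then have inj: "inj ?g"
    using \<open>inj f\<close> by (intro inj_compose)
  have unflat_im: "unflat ` ?supp S = {X :: 'k ^ 'm ^ 'n. \<forall>j i. (j, i) \<notin> S \<longrightarrow> X $ j $ i = 0}" for S
  proof (intro equalityI subsetI)
    fix X :: "'k ^ 'm ^ 'n" assume "X \<in> {X. \<forall>j i. (j, i) \<notin> S \<longrightarrow> X $ j $ i = 0}"
    then have "flat X \<in> ?supp S" by (auto simp: flat_def)
    then show "X \<in> unflat ` ?supp S" by (rule image_eqI[where f = unflat, OF inverse(1)[of X, symmetric]])
  qed (auto simp: unflat_def)
  have "?g ` ?supp S = flat ` unflat ` ?supp T"
    unfolding image_comp[symmetric] unflat_im im ..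
  also have "\<dots> = ?supp T" by (simp add: image_image inverse)
  finally have "?g ` ?supp S = ?supp T" .
  moreover have "vec.dim (?g ` ?supp S) = vec.dim (?supp S)"
    using lin inj_on_subset[OF inj] by (intro vec.dim_image_eq) auto
  ultimately show ?thesis by (simp only: dim_substandard_cart)
qed

text \<open>An isomorphism preserves the centre and the span of the brackets, hence their
  intersection, which is the annihilator for nonzero \<open>b\<close>.\<close>

lemma sandwich_isomorphic_annihilator:
  fixes b b' :: "'k::field_char_0 ^ 'n ^ 'm"
  assumes "lie_isomorphic mat_scale UNIV (sandwich_bracket b) mat_scale UNIV (sandwich_bracket b')"
    and "b \<noteq> 0" "b' \<noteq> 0"
  obtains f where "Vector_Spaces.linear mat_scale mat_scale f" "inj f" "f ` annihilator b = annihilator b'"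
proof -
  obtain f where f: "bij f" "\<And>X Y. f (X + Y) = f X + f Y" "\<And>c X. f (mat_scale c X) = mat_scale c (f X)"
    "\<And>X Y. f (sandwich_bracket b X Y) = sandwich_bracket b' (f X) (f Y)"
    using assms(1) unfolding lie_isomorphic_def by auto
  have lin: "Vector_Spaces.linear mat_scale mat_scale f"
    by unfold_locales (auto simp: f)
  then interpret f: Vector_Spaces.linear mat_scale mat_scale f .
  have inv: "f (inv f X) = X" for X using f(1) by (simp add: bij_is_surj surj_f_inv_f)
  have center_iff: "f X \<in> center (sandwich_bracket b') \<longleftrightarrow> X \<in> center (sandwich_bracket b)" for X
  proof
    assume "f X \<in> center (sandwich_bracket b')"
    then have "f (sandwich_bracket b X Y) = f 0" for Y
      by (simp add: center_def f(4) f.zero)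
    then have "sandwich_bracket b X Y = 0" for Y
      by (rule injD[OF bij_is_inj[OF f(1)]])
    then show "X \<in> center (sandwich_bracket b)"
      by (simp add: center_def)
  next
    assume "X \<in> center (sandwich_bracket b)"
    then have "sandwich_bracket b' (f X) (f (inv f Y)) = 0" for Y
      by (simp add: center_def f.zero flip: f(4))
    then show "f X \<in> center (sandwich_bracket b')"
      by (simp add: center_def inv)
  qed
  have center: "f ` center (sandwich_bracket b) = center (sandwich_bracket b')"
  proof (intro equalityI subsetI)
    fix Z assume "Z \<in> center (sandwich_bracket b')"
    then have "inv f Z \<in> center (sandwich_bracket b)" by (simp add: inv flip: center_iff)
    then show "Z \<in> f ` center (sandwich_bracket b)" by (intro image_eqI[of Z f "inv f Z"]) (simp_all add: inv)
  qed (auto simp: center_iff)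
  have "f ` range (\<lambda>(X, Y). sandwich_bracket b X Y) = range (\<lambda>(X, Y). sandwich_bracket b' X Y)"
  proof (intro equalityI subsetI)
    fix Z assume "Z \<in> range (\<lambda>(X, Y). sandwich_bracket b' X Y)"
    then obtain X Y where "Z = sandwich_bracket b' X Y" by auto
    then have "Z = f (sandwich_bracket b (inv f X) (inv f Y))" by (simp add: f(4) inv)
    then show "Z \<in> f ` range (\<lambda>(X, Y). sandwich_bracket b X Y)" by auto
  qed (force simp: f(4))
  then have "f ` mat_scale.span (range (\<lambda>(X, Y). sandwich_bracket b X Y))
    = mat_scale.span (range (\<lambda>(X, Y). sandwich_bracket b' X Y))"
    by (simp flip: f.span_image)
  then have "f ` annihilator b = annihilator b'"
    unfolding center_Int_derived_sandwich[OF assms(2), symmetric] center_Int_derived_sandwich[OF assms(3), symmetric]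
    using center by (simp add: image_Int[OF bij_is_inj[OF f(1)]])
  then show ?thesis using that lin bij_is_inj[OF f(1)] by blast
qed

section \<open>Recognising the zero matrix by commutativity\<close>

lemma ex_other:
  assumes "CARD('a) \<noteq> 1"
  shows "\<exists>y. y \<noteq> (x :: 'a)"
proof (rule ccontr)
  assume "\<nexists>y. y \<noteq> x"
  then have "(UNIV :: 'a set) = {x}" by auto
  then have "CARD('a) = card {x}" by (rule arg_cong)
  then show False using assms by simp
qed

lemma sandwich_not_abelian:
  fixes b :: "'k::field ^ 'n ^ 'm"
  assumes "(CARD('m), CARD('n)) \<noteq> (1, 1)" "b \<noteq> 0"
  obtains X Y where "sandwich_bracket b X Y \<noteq> 0"
proof -
  obtain p q where pq: "b $ p $ q \<noteq> 0"
    using assms by (auto simp: vec_eq_iff)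
  have "\<exists>X Y. sandwich_bracket b X Y \<noteq> 0"
  proof (cases "CARD('m) = 1")
    case False
    then obtain p' where "p' \<noteq> p" using ex_other[where x = p] by blast
    \<comment> \<open>The bracket is \<open>b $ p' $ q\<close> times the unit at
      \<open>(q, p)\<close> minus \<open>b $ p $ q\<close> times the unit at \<open>(q, p')\<close>;
      as \<open>p'\<close> differs from \<open>p\<close>, the second term survives.\<close>
    then have "sandwich_bracket b (matrix_unit q p') (matrix_unit q p) $ q $ p' \<noteq> 0"
      using pq by (simp add: sandwich_bracket_def mult_matrix_unit matrix_unit_mult)
    then have "sandwich_bracket b (matrix_unit q p') (matrix_unit q p) \<noteq> 0" by auto
    then show ?thesis by blast
  next
    case True
    then obtain q' where "q' \<noteq> q" using assms(1) ex_other[where x = q] by auto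
    \<comment> \<open>Symmetrically, the coefficient of the unit at \<open>(q', p)\<close> is
      \<open>b $ p $ q\<close>.\<close>
    then have "sandwich_bracket b (matrix_unit q' p) (matrix_unit q p) $ q' $ p \<noteq> 0"
      using pq by (simp add: sandwich_bracket_def mult_matrix_unit matrix_unit_mult)
    then have "sandwich_bracket b (matrix_unit q' p) (matrix_unit q p) \<noteq> 0" by auto
    then show ?thesis by blast
  qed
  then show ?thesis using that by blast
qed

text \<open>The annihilator dimension \<open>(n - k) * (m - k)\<close> determines \<open>k\<close>.
  Empty \<open>K\<close> is separate: the bracket then vanishes, so its derived algebra is zero
  although the annihilator is everything.\<close>

lemma sandwich_isomorphic_pivot_matrix:
  fixes h h' :: "'m::finite \<Rightarrow> 'n::finite"
  assumes iso: "lie_isomorphic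
      mat_scale UNIV (sandwich_bracket (pivot_matrix K h :: 'k::field_char_0 ^ 'n ^ 'm))
      mat_scale UNIV (sandwich_bracket (pivot_matrix K' h' :: 'k ^ 'n ^ 'm))"
    and mn: "(CARD('m), CARD('n)) \<noteq> (1, 1)" and h: "inj_on h K" and h': "inj_on h' K'"
  shows "card K = card K'"
proof (cases "K = {} \<or> K' = {}")
  case True
  \<comment> \<open>Stated for arbitrary pivots so that it applies to the isomorphism and to its
    inverse.\<close>
  have empty: "L' = {}"
    if "L = {}" "lie_isomorphic
      mat_scale UNIV (sandwich_bracket (pivot_matrix L g :: 'k ^ 'n ^ 'm))
      mat_scale UNIV (sandwich_bracket (pivot_matrix L' g' :: 'k ^ 'n ^ 'm))"
    for L L' :: "'m set" and g g' :: "'m \<Rightarrow> 'n"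
  proof (rule ccontr)
    assume "L' \<noteq> {}"
    then have "(pivot_matrix L' g' :: 'k ^ 'n ^ 'm) \<noteq> 0"
      by (auto simp: pivot_matrix_def vec_eq_iff)
    then obtain X Y where XY: "sandwich_bracket (pivot_matrix L' g' :: 'k ^ 'n ^ 'm) X Y \<noteq> 0"
      using sandwich_not_abelian[OF mn] by blast
    have "(pivot_matrix L g :: 'k ^ 'n ^ 'm) = 0"
      using that(1) by (simp add: pivot_matrix_def vec_eq_iff)
    with that(2) obtain f :: "'k ^ 'm ^ 'n \<Rightarrow> 'k ^ 'm ^ 'n" where f: "bij f" "\<And>X Y. f (X + Y) = f X + f Y"
      "\<And>X Y. f 0 = sandwich_bracket (pivot_matrix L' g' :: 'k ^ 'n ^ 'm) (f X) (f Y)"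
      unfolding lie_isomorphic_def by (auto simp: sandwich_bracket_def)
    have "f 0 = 0" using f(2)[of 0 0] by simp
    moreover obtain U where "X = f U" using bij_is_surj[OF f(1)] by (rule surjE)
    moreover obtain V where "Y = f V" using bij_is_surj[OF f(1)] by (rule surjE)
    ultimately show False using f(3)[of U V] XY by simp
  qed
  show ?thesis
    using True empty[OF _ iso] empty[OF _ lie_algebra.lie_isomorphic_sym[OF lie_algebra_sandwich iso]]
    by auto
next
  case False
  then have "(pivot_matrix K h :: 'k ^ 'n ^ 'm) \<noteq> 0" "(pivot_matrix K' h' :: 'k ^ 'n ^ 'm) \<noteq> 0"
    by (auto simp: pivot_matrix_def vec_eq_iff)
  then obtain f :: "'k ^ 'm ^ 'n \<Rightarrow> 'k ^ 'm ^ 'n" where f: "Vector_Spaces.linear mat_scale mat_scale f" "inj f"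
    "f ` annihilator (pivot_matrix K h) = annihilator (pivot_matrix K' h')"
    using sandwich_isomorphic_annihilator[OF iso] by blast
  have "card ((- h ` K) \<times> (- K)) = card ((- h' ` K') \<times> (- K'))"
    using f(3) unfolding annihilator_pivot_matrix[OF h] annihilator_pivot_matrix[OF h']
    by (rule card_eq_of_linear_bij[OF f(1,2)])
  then have eq: "(CARD('n) - card K) * (CARD('m) - card K) = (CARD('n) - card K') * (CARD('m) - card K')"
    by (simp add: card_cartesian_product Compl_eq_Diff_UNIV card_Diff_subset card_image h h')
  have less: "(n - l) * (m - l) < (n - k) * (m - k)" if "k < l" "l \<le> m" "l \<le> n" for k l m n :: nat
  proof -
    have "(n - l) * (m - l) \<le> (n - l) * (m - k)" using that by (intro mult_le_mono) auto
    also have "\<dots> < (n - k) * (m - k)" using that by (intro mult_less_mono1) auto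
    finally show ?thesis .
  qed
  have "card K \<le> CARD('m)" "card K' \<le> CARD('m)" "card K \<le> CARD('n)" "card K' \<le> CARD('n)"
    using card_inj_on_le[OF h, of UNIV] card_inj_on_le[OF h', of UNIV] by (auto intro: card_mono)
  then show ?thesis
    using eq less[of "card K" "card K'" "CARD('m)" "CARD('n)"] less[of "card K'" "card K" "CARD('m)" "CARD('n)"]
    by (cases "card K" "card K'" rule: linorder_cases) auto
qed

section \<open>Pivots for every admissible rank, and the classification\<close>

lemma ex_pivots:
  assumes "r \<le> CARD('m)" "r \<le> CARD('n)"
  obtains K :: "'m::finite set" and h :: "'m \<Rightarrow> 'n::finite" where "inj_on h K" "card K = r"
proof -
  obtain K :: "'m set" where K: "card K = r" using obtain_subset_with_card_n[OF assms(1)] by auto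
  obtain J :: "'n set" where J: "card J = r" using obtain_subset_with_card_n[OF assms(2)] by auto
  obtain h where "bij_betw h K J" using finite_same_card_bij[of K J] K J by auto
  then show ?thesis using that K by (auto simp: bij_betw_def)
qed

lemma rank_le_card:
  fixes A :: "'k::field ^ 'n ^ 'm"
  shows "rank A \<le> CARD('m)" "rank A \<le> CARD('n)"
proof -
  show "rank A \<le> CARD('n)"
    unfolding row_rank_def_gen by (rule dim_subset_UNIV_cart_gen)
  have rows: "rows A = range (\<lambda>i. row i A)" by (auto simp: rows_def)
  have "rank A \<le> card (rows A)"
    unfolding row_rank_def_gen by (rule vec.dim_le_card) (auto intro: vec.span_base simp: rows)
  also have "\<dots> \<le> CARD('m)"
    unfolding rows by (rule card_image_le) simp
  finally show "rank A \<le> CARD('m)" .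
qed

theorem theorem4:
  fixes B_i B_j :: "('k::field_char_0, 'm::finite, 'n::finite) gl"
    and r_i r_j :: nat
  assumes "(CARD('m), CARD('n)) \<noteq> (1, 1)"
    and "B_i \<in> gl_component 1" and "B_j \<in> gl_component 1"
    and "rank B_i = r_i" and "rank B_j = r_j"
  shows "lie_isomorphic mat_scale (gl_component (-1)) (derived_bracket B_i)
                        mat_scale (gl_component (-1)) (derived_bracket B_j)
         \<longleftrightarrow> r_i = r_j"
proof -
  \<comment> \<open>\<open>K\<close> and \<open>h\<close> stay arbitrary so that matrices of equal
    rank can share one model.\<close>
  have model: "lie_isomorphic mat_scale (gl_component (-1)) (derived_bracket B)
      mat_scale UNIV (sandwich_bracket (pivot_matrix K h :: 'k ^ 'n ^ 'm))"
    if B: "B \<in> gl_component 1" and K: "inj_on h K" "card K = rank B"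
    for B :: "('k, 'm, 'n) gl" and K h
  proof -
    have "card K = rank (upper_block B)" using K(2) rank_upper_block[OF B] by simp
    then obtain P :: "'k ^ 'm ^ 'm" and Q :: "'k ^ 'n ^ 'n"
      where PQ: "invertible P" "invertible Q" "upper_block B = P ** pivot_matrix K h ** Q"
      by (rule rank_normal_form[OF K(1)])
    show ?thesis
      using derived_bracket_sandwich[OF B] unfolding PQ(3)
      by (rule lie_isomorphic_trans) (rule sandwich_isomorphic_equivalent[OF PQ(1,2)])
  qed
  note sym = lie_algebra.lie_isomorphic_sym[OF lie_algebra_derived_bracket]
  \<comment> \<open>The bounds come from the rectangular block; the size of \<open>B\<close> itself
    only gives \<open>m + n\<close>.\<close>
  have bound: "rank B \<le> CARD('m)" "rank B \<le> CARD('n)" if "B \<in> gl_component 1" for B :: "('k, 'm, 'n) gl"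
    using rank_le_card[of "upper_block B"] rank_upper_block[OF that] by simp_all
  obtain K :: "'m set" and h :: "'m \<Rightarrow> 'n" where K: "inj_on h K" "card K = rank B_i"
    by (rule ex_pivots[OF bound[OF assms(2)]])
  note model_i = model[OF assms(2) K]
  show ?thesis
  proof
    assume iso: "lie_isomorphic mat_scale (gl_component (-1)) (derived_bracket B_i)
      mat_scale (gl_component (-1)) (derived_bracket B_j)"
    obtain K' :: "'m set" and h' :: "'m \<Rightarrow> 'n" where K': "inj_on h' K'" "card K' = rank B_j"
      by (rule ex_pivots[OF bound[OF assms(3)]])
    note lie_isomorphic_trans[OF lie_isomorphic_trans[OF sym[OF assms(2) model_i] iso] model[OF assms(3) K']]
    from sandwich_isomorphic_pivot_matrix[OF this assms(1) K(1) K'(1)] show "r_i = r_j"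
      using K(2) K'(2) assms(4,5) by simp
  next
    assume "r_i = r_j"
    then have "card K = rank B_j" using K(2) assms(4,5) by simp
    from lie_isomorphic_trans[OF model_i sym[OF assms(3) model[OF assms(3) K(1) this]]]
    show "lie_isomorphic mat_scale (gl_component (-1)) (derived_bracket B_i)
      mat_scale (gl_component (-1)) (derived_bracket B_j)" .
  qed
qed

end
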